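(* Fix $X_2=x_2.E_2$ with $x_2\in U$, $E_2\in\mathfrak g$, and fix $E_1\in\mathfrak g$. Define, as functions of $x_1$, $\mathcal D_0(x_1;X_2)=\frac{M(X_2)}{(x_1-x_2)^2}$ and $\mathcal D_{k+1}(x_1;X_2)=\frac{d}{dx_1}\mathcal D_k(x_1;X_2)+[\mathcal D_k(x_1;X_2),\mathcal D(x_1)]$. Then there exist coefficients $\alpha_k(x_1;X_2)$, $k=0,\dots,\dim\mathfrak g$, each a polynomial in $x_1$ (with coefficients depending on $X_2$), not all zero, such that $\sum_{k=0}^{\dim\mathfrak g}\alpha_k(x_1;X_2)\mathcal D_k(x_1;X_2)=0$ and $$\sum_{k=0}^{\dim\mathfrak g}\alpha_k(x_1;X_2)\frac{d^k}{dx_1^k}W_2(x_1.E_1,X_2)=0$$ for $x_1\in U\setminus\{x_2\}$.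
   Context: Let $G\subset GL(r,\mathbb C)$ be a complex reductive Lie group given in a faithful matrix representation, with Lie algebra $\mathfrak g\subset\mathfrak{gl}(r,\mathbb C)$; ${\rm Tr}$ denotes the matrix trace. Let $\mathcal D(x)$ be an $r\times r$ matrix with rational entries in $x$, $\mathcal D(x)\in\mathfrak g$. Let $\Psi(x)$ be a holomorphic $G$-valued solution of $\frac{d}{dx}\Psi=\mathcal D\Psi$ on a simply connected domain $U\subset\mathbb C$ avoiding the poles of $\mathcal D$. For $x\in U$, $E\in\mathfrak g$, write $x.E$ for the pair and $M(x.E)=\Psi(x)E\Psi(x)^{-1}$. For $X_i=x_i.E_i$ with $x_1\ne x_2$ define $W_2(X_1,X_2)=\frac{1}{(x_1-x_2)^2}{\rm Tr}\,M(X_1)M(X_2)$. *)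

theory Defs
  imports "HOL-Analysis.Analysis" "HOL-Computational_Algebra.Polynomial"
begin

text \<open>Complex r x r matrices are modelled as complex^'n^'n, with r = CARD('n).\<close>

definition cmat_scale :: "complex \<Rightarrow> complex^'n^'n \<Rightarrow> complex^'n^'n" (infixr "\<odot>" 75)
  where "c \<odot> A = (\<chi> i j. c * A $ i $ j)"

lemma vector_space_cmat_scale: "vector_space cmat_scale"
  by unfold_locales (simp_all add: cmat_scale_def vec_eq_iff distrib_left distrib_right mult.assoc)

text \<open>Complex dimension of a set (subspace) of matrices.\<close>
definition cdim :: "(complex^'n^'n) set \<Rightarrow> nat"
  where "cdim S = vector_space.dim cmat_scale S"

definition csubspace :: "(complex^'n^'n) set \<Rightarrow> bool"
  where "csubspace S = module.subspace cmat_scale S"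

text \<open>Matrix commutator.\<close>
definition mbracket :: "complex^'n^'n \<Rightarrow> complex^'n^'n \<Rightarrow> complex^'n^'n"
  where "mbracket A B = A ** B - B ** A"

text \<open>Matrix exponential.\<close>
definition mexp :: "complex^'n^'n \<Rightarrow> complex^'n^'n"
  where "mexp A = (\<Sum>k. (1 / fact k) \<odot> (((**) A) ^^ k) (mat 1))"

text \<open>G is a (topologically) closed subgroup of GL(r,C) whose Lie algebra
  g = {A. exp(tA) in G for all real t} is a complex subspace (complex Lie subgroup).\<close>
definition complex_linear_lie_group :: "(complex^'n^'n) set \<Rightarrow> (complex^'n^'n) set \<Rightarrow> bool"
  where "complex_linear_lie_group G g \<longleftrightarrow>
     G \<subseteq> {A. invertible A} \<and> mat 1 \<in> G \<and>
     (\<forall>A\<in>G. \<forall>B\<in>G. A ** B \<in> G) \<and> (\<forall>A\<in>G. matrix_inv A \<in> G) \<and>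
     closedin (top_of_set {A. invertible A}) G \<and>
     g = {A. \<forall>t::real. mexp (t *\<^sub>R A) \<in> G} \<and>
     csubspace g"

text \<open>Ideals of a matrix Lie algebra and reductivity
  (every ideal has a complementary ideal).\<close>
definition lie_ideal :: "(complex^'n^'n) set \<Rightarrow> (complex^'n^'n) set \<Rightarrow> bool"
  where "lie_ideal g I \<longleftrightarrow> csubspace I \<and> I \<subseteq> g \<and> (\<forall>A\<in>g. \<forall>B\<in>I. mbracket A B \<in> I)"

definition reductive_lie_algebra :: "(complex^'n^'n) set \<Rightarrow> bool"
  where "reductive_lie_algebra g \<longleftrightarrow>
     csubspace g \<and> (\<forall>A\<in>g. \<forall>B\<in>g. mbracket A B \<in> g) \<and>
     (\<forall>I. lie_ideal g I \<longrightarrow>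
        (\<exists>J. lie_ideal g J \<and> I \<inter> J = {0} \<and> (\<forall>A\<in>g. \<exists>B\<in>I. \<exists>C\<in>J. A = B + C)))"

definition complex_reductive_lie_group :: "(complex^'n^'n) set \<Rightarrow> (complex^'n^'n) set \<Rightarrow> bool"
  where "complex_reductive_lie_group G g \<longleftrightarrow>
     complex_linear_lie_group G g \<and> reductive_lie_algebra g"

text \<open>D is a matrix of rational functions none of whose poles lies in U.\<close>
definition rational_matrix_no_poles_on :: "(complex \<Rightarrow> complex^'n^'n) \<Rightarrow> complex set \<Rightarrow> bool"
  where "rational_matrix_no_poles_on D U \<longleftrightarrow>
     (\<exists>P Q. \<forall>i j. Q i j \<noteq> (0::complex poly) \<and>
        (\<forall>x. D x $ i $ j = poly (P i j) x / poly (Q i j) x) \<and>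
        (\<forall>x\<in>U. poly (Q i j) x \<noteq> 0))"

text \<open>Entrywise complex derivative of a matrix-valued function.\<close>
definition mderiv :: "(complex \<Rightarrow> complex^'n^'n) \<Rightarrow> complex \<Rightarrow> complex^'n^'n"
  where "mderiv F x = (\<chi> i j. deriv (\<lambda>y. F y $ i $ j) x)"

text \<open>Psi is holomorphic on U, G-valued, and solves Psi' = D Psi.\<close>
definition fundamental_solution ::
  "(complex \<Rightarrow> complex^'n^'n) \<Rightarrow> (complex \<Rightarrow> complex^'n^'n) \<Rightarrow> (complex^'n^'n) set \<Rightarrow> complex set \<Rightarrow> bool"
  where "fundamental_solution \<Psi> D G U \<longleftrightarrow>
     (\<forall>i j. (\<lambda>x. \<Psi> x $ i $ j) holomorphic_on U) \<and>
     (\<forall>x\<in>U. \<Psi> x \<in> G) \<and>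
     (\<forall>x\<in>U. \<forall>i j. ((\<lambda>y. \<Psi> y $ i $ j) has_field_derivative (D x ** \<Psi> x) $ i $ j) (at x))"

text \<open>M(x.E) = Psi(x) E Psi(x)^{-1}.\<close>
definition Mconj :: "(complex \<Rightarrow> complex^'n^'n) \<Rightarrow> complex \<Rightarrow> complex^'n^'n \<Rightarrow> complex^'n^'n"
  where "Mconj \<Psi> x E = \<Psi> x ** E ** matrix_inv (\<Psi> x)"

text \<open>W_2(X_1,X_2) = Tr(M(X_1) M(X_2)) / (x_1-x_2)^2.\<close>
definition W2 :: "(complex \<Rightarrow> complex^'n^'n) \<Rightarrow> complex \<Rightarrow> complex^'n^'n \<Rightarrow> complex \<Rightarrow> complex^'n^'n \<Rightarrow> complex"
  where "W2 \<Psi> x1 E1 x2 E2 = trace (Mconj \<Psi> x1 E1 ** Mconj \<Psi> x2 E2) / (x1 - x2)^2"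

text \<open>The sequence D_k(x_1; X_2).\<close>
fun Dk :: "(complex \<Rightarrow> complex^'n^'n) \<Rightarrow> (complex \<Rightarrow> complex^'n^'n) \<Rightarrow> complex \<Rightarrow> complex^'n^'n
            \<Rightarrow> nat \<Rightarrow> complex \<Rightarrow> complex^'n^'n" where
  "Dk \<Psi> D x2 E2 0 = (\<lambda>x1. (1 / (x1 - x2)^2) \<odot> Mconj \<Psi> x2 E2)"
| "Dk \<Psi> D x2 E2 (Suc k) = (\<lambda>x1. mderiv (Dk \<Psi> D x2 E2 k) x1 + mbracket (Dk \<Psi> D x2 E2 k x1) (D x1))"

end

theory Submission
  imports Defs
begin

text \<open>Every \<open>D\<^sub>k\<close> takes values in \<open>g\<close>: \<open>D\<^sub>0\<close> is a multiple of \<open>Ad(\<Psi>(x\<^sub>2)) E\<^sub>2\<close>, and the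
  step from \<open>D\<^sub>k\<close> to \<open>D\<^sub>k\<^sub>+\<^sub>1\<close> only differentiates a \<open>g\<close>-valued function and brackets
  with \<open>D(x\<^sub>1) \<in> g\<close>. The entries of \<open>D\<^sub>k\<close> are rational with denominator \<open>d\<^sup>k\<^sup>+\<^sup>2\<close> for a single
  polynomial \<open>d\<close>, so \<open>D\<^sub>0, \<dots>, D\<^sub>m\<close> with \<open>m = dim g\<close> are \<open>m + 1\<close> vectors in an
  \<open>m\<close>-dimensional space over the rational functions and satisfy a nontrivial relation with
  polynomial coefficients. Since \<open>\<Psi>' = D \<Psi>\<close> gives \<open>M(x.E)' = [D, M(x.E)]\<close>, differentiating
  \<open>Tr (M(x\<^sub>1.E\<^sub>1) F)\<close> yields \<open>Tr (M(x\<^sub>1.E\<^sub>1) (F' + [F, D]))\<close>; starting from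
  \<open>W\<^sub>2 = Tr (M(x\<^sub>1.E\<^sub>1) D\<^sub>0)\<close> this gives \<open>d\<^sup>kW\<^sub>2/dx\<^sub>1\<^sup>k = Tr (M(x\<^sub>1.E\<^sub>1) D\<^sub>k)\<close>, so the same
  relation annihilates the derivatives of \<open>W\<^sub>2\<close>.\<close>

section \<open>Linear algebra\<close>

lemma nontrivial_relation_if_card_less:
  fixes v :: "'k \<Rightarrow> 'i \<Rightarrow> 'a::idom"
  assumes "finite I" "finite K" "card I < card K"
  shows "\<exists>\<alpha>. (\<exists>k\<in>K. \<alpha> k \<noteq> 0) \<and> (\<forall>i\<in>I. (\<Sum>k\<in>K. \<alpha> k * v k i) = 0)"
  using assms
proof (induction I arbitrary: K v rule: finite_induct)
  case empty
  then have "K \<noteq> {}" by auto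
  then show ?case by (intro exI[of _ "\<lambda>_. 1"]) auto
next
  case (insert i I)
  show ?case
  proof (cases "\<forall>k\<in>K. v k i = 0")
    case True
    with insert.IH[of K v] insert.prems insert.hyps show ?thesis by auto
  next
    case False
    then obtain j where j: "j \<in> K" "v j i \<noteq> 0" by auto
    \<comment> \<open>Fraction-free elimination: pivot on \<open>v j i\<close> to clear coordinate \<open>i\<close> from the other vectors.\<close>
    define w where "w k l = v j i * v k l - v k i * v j l" for k l
    have "card I < card (K - {j})" using insert j by auto
    with insert.IH[of "K - {j}" w] insert.prems obtain \<beta>
      where \<beta>_nz: "\<exists>k\<in>K - {j}. \<beta> k \<noteq> 0" and \<beta>_rel: "\<forall>l\<in>I. (\<Sum>k\<in>K - {j}. \<beta> k * w k l) = 0"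
      by auto
    define \<alpha> where "\<alpha> k = (if k = j then - (\<Sum>k\<in>K - {j}. \<beta> k * v k i) else v j i * \<beta> k)" for k
    have \<alpha>_rel: "(\<Sum>k\<in>K. \<alpha> k * v k l) = (\<Sum>k\<in>K - {j}. \<beta> k * w k l)" for l
    proof -
      have "(\<Sum>k\<in>K. \<alpha> k * v k l) = \<alpha> j * v j l + (\<Sum>k\<in>K - {j}. \<alpha> k * v k l)"
        using j insert.prems by (simp add: sum.remove)
      also have "\<dots> = (\<Sum>k\<in>K - {j}. \<beta> k * w k l)"
        by (simp add: \<alpha>_def w_def sum_distrib_right sum_distrib_left sum_subtractf algebra_simps)
      finally show ?thesis .
    qed
    show ?thesis
    proof (intro exI[of _ \<alpha>] conjI ballI)
      show "\<exists>k\<in>K. \<alpha> k \<noteq> 0" using \<beta>_nz j by (auto simp: \<alpha>_def)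
      fix l assume "l \<in> insert i I"
      then show "(\<Sum>k\<in>K. \<alpha> k * v k l) = 0"
        using \<alpha>_rel[of l] \<beta>_rel by (auto simp: w_def)
    qed
  qed
qed

lemma matrix_add_rdistrib: "((A::'a::semiring_1^'n^'m) + B) ** C = A ** C + B ** C"
  by (vector matrix_matrix_mult_def sum.distrib[symmetric] field_simps)

lemma matrix_diff_rdistrib: "((A::'a::ring_1^'n^'m) - B) ** C = A ** C - B ** C"
  by (vector matrix_matrix_mult_def sum_subtractf[symmetric] field_simps)

lemma matrix_diff_ldistrib: "(C::'a::ring_1^'n^'m) ** (A - B) = C ** A - C ** B"
  by (vector matrix_matrix_mult_def sum_subtractf[symmetric] field_simps)

lemma matrix_neg_left: "(- (A::'a::ring_1^'n^'m)) ** B = - (A ** B)"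
  by (vector matrix_matrix_mult_def sum_negf[symmetric])

lemma matrix_neg_right: "(A::'a::ring_1^'n^'m) ** (- B) = - (A ** B)"
  by (vector matrix_matrix_mult_def sum_negf[symmetric])

lemma matrix_inv_right: "invertible (A::'a::semiring_1^'n^'n) \<Longrightarrow> A ** matrix_inv A = mat 1"
  and matrix_inv_left: "invertible (A::'a::semiring_1^'n^'n) \<Longrightarrow> matrix_inv A ** A = mat 1"
  unfolding invertible_def matrix_inv_def by (metis (mono_tags, lifting) someI_ex)+

lemma cmat_scale_nth [simp]: "(c \<odot> A) $ i $ j = c * A $ i $ j"
  by (simp add: cmat_scale_def)

lemma cmat_scale_mult_left: "(c \<odot> A) ** B = c \<odot> (A ** B)"
  by (simp add: vec_eq_iff matrix_matrix_mult_def sum_distrib_left mult.assoc)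

lemma cmat_scale_mult_right: "A ** (c \<odot> B) = c \<odot> (A ** B)"
  by (simp add: vec_eq_iff matrix_matrix_mult_def sum_distrib_left algebra_simps)

lemma trace_cmat_scale: "trace (c \<odot> A) = c * trace A"
  by (simp add: trace_def sum_distrib_left)

lemma trace_mult_sum_scale:
  fixes A :: "complex^'n^'n"
  shows "trace (A ** (\<Sum>k\<in>K. c k \<odot> X k)) = (\<Sum>k\<in>K. c k * trace (A ** X k))"
  by (induction K rule: infinite_finite_induct)
    (simp_all add: trace_def matrix_add_ldistrib cmat_scale_mult_right sum.distrib sum_distrib_left)

lemma trace_mbracket_mult:
  fixes A B C :: "complex^'n^'n"
  shows "trace (mbracket A B ** C) = trace (B ** mbracket C A)"
proof -
  have "trace (A ** B ** C) = trace (B ** C ** A)"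
    by (metis matrix_mul_assoc trace_mul_sym)
  then show ?thesis
    by (simp add: mbracket_def matrix_diff_rdistrib matrix_diff_ldistrib trace_sub matrix_mul_assoc)
qed

definition matrix_unit :: "'n \<Rightarrow> 'n \<Rightarrow> complex^'n^'n"
  where "matrix_unit i j = (\<chi> k l. if k = i \<and> l = j then 1 else 0)"

lemma matrix_unit_expansion: "A = (\<Sum>i\<in>UNIV. \<Sum>j\<in>UNIV. A $ i $ j \<odot> matrix_unit i j)"
proof -
  have "(\<Sum>i\<in>UNIV. \<Sum>j\<in>UNIV. A $ i $ j \<odot> matrix_unit i j) $ k $ l = A $ k $ l" for k l
    by (simp add: sum_component matrix_unit_def if_distrib[of "times _"] if_if_eq_conj[symmetric]
        cong: if_cong) (subst sum.swap, simp)
  then show ?thesis by (simp add: vec_eq_iff)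
qed

section \<open>Derivatives of matrix-valued functions\<close>

definition has_matrix_derivative :: "(complex \<Rightarrow> complex^'n^'m) \<Rightarrow> complex^'n^'m \<Rightarrow> complex \<Rightarrow> bool"
  where "has_matrix_derivative F F' y \<longleftrightarrow>
    (\<forall>i j. ((\<lambda>z. F z $ i $ j) has_field_derivative F' $ i $ j) (at y))"

lemma has_matrix_derivative_const: "has_matrix_derivative (\<lambda>_. A) 0 y"
  by (simp add: has_matrix_derivative_def)

lemma has_matrix_derivative_mult:
  assumes "has_matrix_derivative F F' y" "has_matrix_derivative G G' y"
  shows "has_matrix_derivative (\<lambda>z. F z ** G z) (F' ** G y + F y ** G') y"
  unfolding has_matrix_derivative_def
proof (intro allI)
  fix i j
  have "((\<lambda>z. \<Sum>k\<in>UNIV. F z $ i $ k * G z $ k $ j) has_field_derivative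
        (\<Sum>k\<in>UNIV. F' $ i $ k * G y $ k $ j + F y $ i $ k * G' $ k $ j)) (at y)"
    using assms unfolding has_matrix_derivative_def by (intro DERIV_sum) (auto intro!: derivative_eq_intros)
  then show "((\<lambda>z. (F z ** G z) $ i $ j) has_field_derivative (F' ** G y + F y ** G') $ i $ j) (at y)"
    by (simp add: matrix_matrix_mult_def sum.distrib)
qed

lemma has_matrix_derivative_trace:
  assumes "has_matrix_derivative F F' y"
  shows "((\<lambda>z. trace (F z)) has_field_derivative trace F') (at y)"
  using assms unfolding has_matrix_derivative_def trace_def by (intro DERIV_sum) auto

lemma has_matrix_derivative_transform_within_open:
  assumes "has_matrix_derivative F F' y" "open S" "y \<in> S" "\<And>z. z \<in> S \<Longrightarrow> F z = G z"
  shows "has_matrix_derivative G F' y"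
  using assms has_field_derivative_transform_within_open[of "\<lambda>z. F z $ i $ j" _ y S "\<lambda>z. G z $ i $ j" for i j]
  by (auto simp: has_matrix_derivative_def)

lemma has_matrix_derivative_unique:
  "has_matrix_derivative F F' y \<Longrightarrow> has_matrix_derivative F F'' y \<Longrightarrow> F' = F''"
  unfolding has_matrix_derivative_def vec_eq_iff by (blast intro: DERIV_unique)

lemma mderiv_eqI: "has_matrix_derivative F F' y \<Longrightarrow> mderiv F y = F'"
  unfolding has_matrix_derivative_def mderiv_def vec_eq_iff by (simp add: DERIV_imp_deriv)

lemma has_matrix_derivative_holomorphic:
  assumes "open U" "y \<in> U" "\<And>i j. (\<lambda>z. F z $ i $ j) holomorphic_on U"
  shows "has_matrix_derivative F (mderiv F y) y"
  using assms holomorphic_on_imp_differentiable_at[of "\<lambda>z. F z $ i $ j" U y for i j]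
  by (auto simp: has_matrix_derivative_def mderiv_def DERIV_deriv_iff_field_differentiable)

lemma holomorphic_on_det:
  assumes "\<And>i j. (\<lambda>z. F z $ i $ j) holomorphic_on U"
  shows "(\<lambda>z. det (F z :: complex^'n^'n)) holomorphic_on U"
  unfolding det_def by (intro holomorphic_intros assms)

lemma matrix_inv_cramer:
  fixes A :: "complex^'n^'n"
  assumes "invertible A"
  shows "matrix_inv A $ k $ j = det (\<chi> i l. if l = k then (if i = j then 1 else 0) else A $ i $ l) / det A"
proof -
  let ?b = "(\<chi> i. if i = j then 1 else 0) :: complex^'n"
  have "A *v (matrix_inv A *v ?b) = ?b"
    by (simp add: matrix_vector_mul_assoc matrix_inv_right[OF assms])
  then have "matrix_inv A *v ?b = (\<chi> k. det (\<chi> i l. if l = k then ?b $ i else A $ i $ l) / det A)"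
    using cramer[of A] assms invertible_det_nz by blast
  then have "(matrix_inv A *v ?b) $ k = det (\<chi> i l. if l = k then ?b $ i else A $ i $ l) / det A"
    by simp
  moreover have "(matrix_inv A *v ?b) $ k = matrix_inv A $ k $ j"
    by (simp add: matrix_vector_mult_def if_distrib[of "times _"] cong: if_cong)
  ultimately show ?thesis by (simp cong: if_cong)
qed

lemma holomorphic_on_matrix_inv:
  fixes \<Psi> :: "complex \<Rightarrow> complex^'n^'n"
  assumes "\<And>i j. (\<lambda>z. \<Psi> z $ i $ j) holomorphic_on U" "\<And>z. z \<in> U \<Longrightarrow> invertible (\<Psi> z)"
  shows "(\<lambda>z. matrix_inv (\<Psi> z) $ k $ j) holomorphic_on U"
proof -
  have hol_if: "(\<lambda>z. if c then a else f z) holomorphic_on U" if "f holomorphic_on U" for c a f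
    using that by (cases c) auto
  have "(\<lambda>z. det (\<chi> i l. if l = k then (if i = j then 1 else 0) else \<Psi> z $ i $ l) / det (\<Psi> z))
      holomorphic_on U"
    using assms by (intro holomorphic_on_divide holomorphic_on_det) (auto simp: invertible_det_nz intro!: hol_if)
  then show ?thesis
    by (rule holomorphic_transform) (use assms in \<open>simp add: matrix_inv_cramer\<close>)
qed

lemma has_matrix_derivative_matrix_inv:
  fixes \<Psi> :: "complex \<Rightarrow> complex^'n^'n"
  assumes U: "open U" "y \<in> U" and hol: "\<And>i j. (\<lambda>z. \<Psi> z $ i $ j) holomorphic_on U"
    and inv: "\<And>z. z \<in> U \<Longrightarrow> invertible (\<Psi> z)" and der: "has_matrix_derivative \<Psi> \<Psi>' y"
  shows "has_matrix_derivative (\<lambda>z. matrix_inv (\<Psi> z))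
    (- (matrix_inv (\<Psi> y) ** \<Psi>' ** matrix_inv (\<Psi> y))) y"
proof -
  define \<Phi> where "\<Phi> z = matrix_inv (\<Psi> z)" for z
  define \<Phi>' where "\<Phi>' = mderiv \<Phi> y"
  have d\<Phi>: "has_matrix_derivative \<Phi> \<Phi>' y"
    unfolding \<Phi>'_def \<Phi>_def
    by (rule has_matrix_derivative_holomorphic[OF U holomorphic_on_matrix_inv[OF hol inv]])
  have "has_matrix_derivative (\<lambda>z. \<Phi> z ** \<Psi> z) (\<Phi>' ** \<Psi> y + \<Phi> y ** \<Psi>') y"
    by (rule has_matrix_derivative_mult[OF d\<Phi> der])
  moreover have "has_matrix_derivative (\<lambda>z. \<Phi> z ** \<Psi> z) 0 y"
    by (rule has_matrix_derivative_transform_within_open[OF has_matrix_derivative_const U])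
      (simp add: \<Phi>_def matrix_inv_left inv)
  ultimately have "\<Phi>' ** \<Psi> y = - (\<Phi> y ** \<Psi>')"
    by (simp add: has_matrix_derivative_unique eq_neg_iff_add_eq_0)
  then have "\<Phi>' ** \<Psi> y ** \<Phi> y = - (\<Phi> y ** \<Psi>' ** \<Phi> y)"
    by (simp add: matrix_neg_left)
  then have "\<Phi>' = - (\<Phi> y ** \<Psi>' ** \<Phi> y)"
    using matrix_inv_right[OF inv[OF U(2)]] by (simp add: \<Phi>_def flip: matrix_mul_assoc)
  with d\<Phi> show ?thesis by (simp add: \<Phi>_def[abs_def])
qed

lemma has_matrix_derivative_Mconj:
  assumes "fundamental_solution \<Psi> D G U" "G \<subseteq> {A. invertible A}" "open U" "y \<in> U"
  shows "has_matrix_derivative (\<lambda>x. Mconj \<Psi> x E) (mbracket (D y) (Mconj \<Psi> y E)) y"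
proof -
  have hol: "\<And>i j. (\<lambda>z. \<Psi> z $ i $ j) holomorphic_on U"
    and inv: "\<And>z. z \<in> U \<Longrightarrow> invertible (\<Psi> z)"
    and der: "has_matrix_derivative \<Psi> (D y ** \<Psi> y) y"
    using assms by (auto simp: fundamental_solution_def has_matrix_derivative_def)
  have cancel: "X ** \<Psi> y ** matrix_inv (\<Psi> y) = X" for X
    using matrix_inv_right[OF inv[OF assms(4)]] by (simp flip: matrix_mul_assoc)
  have "has_matrix_derivative (\<lambda>x. \<Psi> x ** E ** matrix_inv (\<Psi> x))
      ((D y ** \<Psi> y ** E + \<Psi> y ** 0) ** matrix_inv (\<Psi> y)
       + \<Psi> y ** E ** - (matrix_inv (\<Psi> y) ** (D y ** \<Psi> y) ** matrix_inv (\<Psi> y))) y"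
    by (intro has_matrix_derivative_mult has_matrix_derivative_const der
        has_matrix_derivative_matrix_inv[OF assms(3,4) hol inv])
  then show ?thesis
    by (simp add: Mconj_def mbracket_def matrix_add_rdistrib matrix_neg_right matrix_mul_assoc cancel)
qed

section \<open>Linear Lie groups and their Lie algebras\<close>

lemma
  assumes "csubspace g"
  shows csubspace_add: "A \<in> g \<Longrightarrow> B \<in> g \<Longrightarrow> A + B \<in> g"
    and csubspace_scale: "A \<in> g \<Longrightarrow> c \<odot> A \<in> g"
    and csubspace_sum_scale: "(\<And>k. k \<in> K \<Longrightarrow> X k \<in> g) \<Longrightarrow> (\<Sum>k\<in>K. a k \<odot> X k) \<in> g"
proof -
  interpret vector_space cmat_scale by (rule vector_space_cmat_scale)
  have "subspace g" using assms by (simp add: csubspace_def)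
  then show "A \<in> g \<Longrightarrow> B \<in> g \<Longrightarrow> A + B \<in> g" "A \<in> g \<Longrightarrow> c \<odot> A \<in> g"
    and "(\<And>k. k \<in> K \<Longrightarrow> X k \<in> g) \<Longrightarrow> (\<Sum>k\<in>K. a k \<odot> X k) \<in> g"
    by (auto intro: subspace_add subspace_scale subspace_sum)
qed

lemma matrix_power_conj:
  fixes P Q X :: "'a::semiring_1^'n^'n"
  assumes "P ** Q = mat 1" "Q ** P = mat 1"
  shows "(((**) (P ** X ** Q)) ^^ k) (mat 1) = P ** (((**) X) ^^ k) (mat 1) ** Q"
proof (induction k)
  case 0
  then show ?case using assms by simp
next
  case (Suc k)
  have "P ** X ** Q ** (P ** (((**) X) ^^ k) (mat 1) ** Q)
      = P ** X ** (Q ** P) ** (((**) X) ^^ k) (mat 1) ** Q"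
    by (simp add: matrix_mul_assoc)
  with Suc assms show ?case by (simp add: matrix_mul_assoc)
qed

lemma suminf_eq_if_not_summable: "\<not> summable f \<Longrightarrow> \<not> summable g \<Longrightarrow> suminf f = suminf g"
  by (simp add: suminf_def summable_def)

lemma bounded_linear_matrix_conj: "bounded_linear (\<lambda>X::complex^'n^'n. P ** X ** Q)"
proof -
  have "linear (\<lambda>X::complex^'n^'n. P ** X ** Q)"
    by (rule linearI) (simp_all add: matrix_add_ldistrib matrix_add_rdistrib scalar_matrix_assoc matrix_scalar_ac)
  then show ?thesis by (simp add: linear_conv_bounded_linear)
qed

lemma conj_mem_lie_algebra:
  fixes G g :: "(complex^'n^'n) set"
  assumes G: "complex_linear_lie_group G g" and P: "P \<in> G" and A: "A \<in> g"
  shows "P ** A ** matrix_inv P \<in> g"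
proof -
  let ?Q = "matrix_inv P"
  have g_def: "g = {A. \<forall>t::real. mexp (t *\<^sub>R A) \<in> G}"
    and Q: "?Q \<in> G" and GG: "\<And>X Y. X \<in> G \<Longrightarrow> Y \<in> G \<Longrightarrow> X ** Y \<in> G"
    and inv: "invertible P"
    using G P unfolding complex_linear_lie_group_def by auto
  define L where "L X = P ** X ** ?Q" for X :: "complex^'n^'n"
  define L' where "L' X = ?Q ** X ** P" for X :: "complex^'n^'n"
  have L: "bounded_linear L" "bounded_linear L'"
    unfolding L_def L'_def by (rule bounded_linear_matrix_conj)+
  have L'L: "L' (L X) = X" for X
  proof -
    have "?Q ** (P ** Y) = Y" for Y
      using matrix_inv_left[OF inv] by (simp add: matrix_mul_assoc)
    then show ?thesis
      using matrix_inv_left[OF inv] by (simp add: L_def L'_def flip: matrix_mul_assoc)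
  qed
  have "mexp (t *\<^sub>R (P ** A ** ?Q)) \<in> G" for t :: real
  proof -
    define f where "f n = (1 / fact n) \<odot> (((**) (t *\<^sub>R A)) ^^ n) (mat 1)" for n
    have "t *\<^sub>R (P ** A ** ?Q) = P ** (t *\<^sub>R A) ** ?Q"
      by (simp add: scalar_matrix_assoc matrix_scalar_ac)
    then have series: "mexp (t *\<^sub>R (P ** A ** ?Q)) = (\<Sum>n. L (f n))"
      unfolding mexp_def L_def f_def
      by (simp add: matrix_power_conj matrix_inv_right[OF inv] matrix_inv_left[OF inv]
          cmat_scale_mult_left cmat_scale_mult_right)
    have exp_A: "mexp (t *\<^sub>R A) = (\<Sum>n. f n)" "mexp (t *\<^sub>R A) \<in> G"
      using A g_def by (auto simp: mexp_def f_def)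
    show ?thesis
    proof (cases "summable f")
      case True
      then have "mexp (t *\<^sub>R (P ** A ** ?Q)) = L (mexp (t *\<^sub>R A))"
        using series exp_A bounded_linear.suminf[OF L(1)] by simp
      then show ?thesis using exp_A(2) P Q GG by (simp add: L_def)
    next
      case False
      \<comment> \<open>The exponential series always converges, but it suffices that both sides are then
        the same junk value: the sum of a non-summable series.\<close>
      have "\<not> summable (\<lambda>n. L (f n))"
        using False bounded_linear.summable[OF L(2), of "\<lambda>n. L (f n)"] by (auto simp: L'L)
      then show ?thesis
        using False series exp_A suminf_eq_if_not_summable by metis
    qed
  qed
  then show ?thesis using g_def by auto
qed

lemma linear_functional_eq_trace:
  fixes f :: "complex^'n^'n \<Rightarrow> complex"
  assumes "Vector_Spaces.linear cmat_scale (*) f"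
  obtains \<Lambda> where "\<And>A. f A = trace (\<Lambda> ** A)"
proof
  interpret f: Vector_Spaces.linear cmat_scale "(*)" f by fact
  fix A :: "complex^'n^'n"
  have "f A = (\<Sum>i\<in>UNIV. \<Sum>j\<in>UNIV. A $ i $ j * f (matrix_unit i j))"
    by (subst matrix_unit_expansion) (simp add: f.sum f.scale)
  also have "\<dots> = trace ((\<chi> j i. f (matrix_unit i j)) ** A)"
    by (simp add: trace_def matrix_matrix_mult_def mult.commute) (rule sum.swap)
  finally show "f A = trace ((\<chi> j i. f (matrix_unit i j)) ** A)" .
qed

lemma csubspace_trace_coordinates:
  fixes g :: "(complex^'n^'n) set"
  assumes "csubspace g"
  obtains B C :: "(complex^'n^'n) set" and coord :: "complex^'n^'n \<Rightarrow> complex^'n^'n"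
  where "finite B" "card B = cdim g"
    "\<And>A. A \<in> g \<longleftrightarrow> (\<forall>c\<in>C. trace (coord c ** A) = 0)"
    "\<And>A. A \<in> g \<Longrightarrow> \<forall>b\<in>B. trace (coord b ** A) = 0 \<Longrightarrow> A = 0"
proof -
  interpret V: vector_space cmat_scale by (rule vector_space_cmat_scale)
  obtain B where B: "B \<subseteq> g" "V.independent B" "g \<subseteq> V.span B" "card B = V.dim g"
    by (rule V.basis_exists)
  have span_B: "V.span B = g"
    using V.span_subspace[OF B(1,3)] assms by (simp add: csubspace_def)
  have "A \<in> V.span (range (case_prod matrix_unit))" for A
    by (subst matrix_unit_expansion[of A]) (intro V.span_sum V.span_scale V.span_base; auto)
  then have "finite B"
    using V.independent_span_bound[OF _ B(2), of "range (case_prod matrix_unit)"] by auto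
  define C where "C = V.extend_basis B"
  have C: "B \<subseteq> C" "V.independent C" "V.span C = UNIV"
    using V.extend_basis_superset V.independent_extend_basis V.span_extend_basis B(2)
    by (auto simp: C_def)
  have "\<exists>\<Lambda>. \<forall>A. V.representation C A b = trace (\<Lambda> ** A)" for b
    using linear_functional_eq_trace[OF V.linear_representation[OF C(2,3)]] by metis
  then obtain coord where coord: "\<And>b A. V.representation C A b = trace (coord b ** A)"
    by metis
  have expansion: "A = (\<Sum>b | V.representation C A b \<noteq> 0. V.representation C A b \<odot> b)" for A
    using V.sum_nonzero_representation_eq[OF C(2)] C(3) by simp
  have in_g: "A \<in> g \<longleftrightarrow> (\<forall>c\<in>C - B. trace (coord c ** A) = 0)" for A
  proof
    assume "A \<in> g"
    then have "V.representation C A = V.representation B A"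
      using V.representation_extend[OF C(2) _ C(1)] span_B by auto
    then show "\<forall>c\<in>C - B. trace (coord c ** A) = 0"
      using V.representation_ne_zero[of B A] by (auto simp flip: coord)
  next
    assume "\<forall>c\<in>C - B. trace (coord c ** A) = 0"
    then have "{b. V.representation C A b \<noteq> 0} \<subseteq> B"
      using V.representation_ne_zero[of C A] coord by auto
    then have "(\<Sum>b | V.representation C A b \<noteq> 0. V.representation C A b \<odot> b) \<in> V.span B"
      by (intro V.span_sum V.span_scale V.span_base) auto
    then show "A \<in> g" using expansion[of A] span_B by simp
  qed
  show ?thesis
  proof (rule that[of B "C - B" coord])
    show "finite B" by fact
    show "card B = cdim g" using B(4) by (simp add: cdim_def)
    show "A \<in> g \<longleftrightarrow> (\<forall>c\<in>C - B. trace (coord c ** A) = 0)" for A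
      by (rule in_g)
    show "A = 0" if "A \<in> g" "\<forall>b\<in>B. trace (coord b ** A) = 0" for A
    proof -
      have "V.representation C A b = 0" for b
        using that in_g[of A] V.representation_ne_zero[of C A b] C(1) by (auto simp: coord)
      then show ?thesis using expansion[of A] by simp
    qed
  qed
qed

lemma has_matrix_derivative_in_csubspace:
  fixes g :: "(complex^'n^'n) set"
  assumes g: "csubspace g" and S: "open S" "y \<in> S" and F: "\<And>z. z \<in> S \<Longrightarrow> F z \<in> g"
    and der: "has_matrix_derivative F F' y"
  shows "F' \<in> g"
proof -
  obtain C :: "(complex^'n^'n) set" and coord
    where coords: "\<And>A. A \<in> g \<longleftrightarrow> (\<forall>c\<in>C. trace (coord c ** A) = 0)"
    using csubspace_trace_coordinates[OF g] by metis
  have "trace (coord c ** F') = 0" if "c \<in> C" for c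
  proof -
    have "((\<lambda>z. trace (coord c ** F z)) has_field_derivative trace (coord c ** F')) (at y)"
      using has_matrix_derivative_trace[OF has_matrix_derivative_mult[OF has_matrix_derivative_const der]]
      by simp
    moreover have "((\<lambda>z. trace (coord c ** F z)) has_field_derivative 0) (at y)"
      by (rule has_field_derivative_transform_within_open[OF DERIV_const S])
        (use F coords that in auto)
    ultimately show ?thesis by (rule DERIV_unique)
  qed
  then show ?thesis using coords by blast
qed

section \<open>Rational matrix functions\<close>

lemma poly_div_power_common_denominator:
  fixes p d :: "'a::field poly"
  assumes "k \<le> m" "poly d z \<noteq> 0"
  shows "poly p z / poly d z ^ (k + e) = poly (p * d ^ (m - k)) z / poly (d ^ (m + e)) z"
proof -
  have "poly d z ^ (m + e) = poly d z ^ (k + e) * poly d z ^ (m - k)"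
    using assms(1) by (simp add: add.commute flip: power_add)
  then show ?thesis using assms(2) by (simp add: poly_power)
qed

lemma polynomial_relation_in_csubspace:
  fixes F :: "nat \<Rightarrow> complex \<Rightarrow> complex^'n^'n"
  assumes g: "csubspace g"
    and F_in: "\<And>k z. k \<le> cdim g \<Longrightarrow> z \<in> S \<Longrightarrow> F k z \<in> g"
    and F_rat: "\<And>k z i j. k \<le> cdim g \<Longrightarrow> z \<in> S \<Longrightarrow> F k z $ i $ j = poly (N k i j) z / poly d z"
  shows "\<exists>\<alpha>. (\<exists>k\<le>cdim g. \<alpha> k \<noteq> 0) \<and> (\<forall>z\<in>S. (\<Sum>k\<le>cdim g. poly (\<alpha> k) z \<odot> F k z) = 0)"
proof -
  obtain B :: "(complex^'n^'n) set" and coord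
    where B: "finite B" "card B = cdim g"
      and coord_zero: "\<And>A. A \<in> g \<Longrightarrow> \<forall>b\<in>B. trace (coord b ** A) = 0 \<Longrightarrow> A = 0"
    using csubspace_trace_coordinates[OF g] by metis
  define a where "a k b = (\<Sum>i\<in>UNIV. \<Sum>j\<in>UNIV. smult (coord b $ i $ j) (N k j i))" for k b
  have coord_F: "trace (coord b ** F k z) = poly (a k b) z / poly d z"
    if "k \<le> cdim g" "z \<in> S" for k b z
    by (simp add: trace_def matrix_matrix_mult_def F_rat[OF that] a_def poly_sum sum_divide_distrib)
  have "card B < card {..cdim g}" using B by simp
  then obtain \<alpha> where \<alpha>: "\<exists>k\<in>{..cdim g}. \<alpha> k \<noteq> 0" "\<forall>b\<in>B. (\<Sum>k\<in>{..cdim g}. \<alpha> k * a k b) = 0"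
    using nontrivial_relation_if_card_less[OF B(1), of "{..cdim g}" a] by auto
  have "(\<Sum>k\<le>cdim g. poly (\<alpha> k) z \<odot> F k z) = 0" if z: "z \<in> S" for z
  proof (rule coord_zero)
    show "(\<Sum>k\<le>cdim g. poly (\<alpha> k) z \<odot> F k z) \<in> g"
      using F_in z by (intro csubspace_sum_scale[OF g]) auto
    show "\<forall>b\<in>B. trace (coord b ** (\<Sum>k\<le>cdim g. poly (\<alpha> k) z \<odot> F k z)) = 0"
    proof
      fix b assume "b \<in> B"
      have "trace (coord b ** (\<Sum>k\<le>cdim g. poly (\<alpha> k) z \<odot> F k z))
          = (\<Sum>k\<le>cdim g. poly (\<alpha> k) z * (poly (a k b) z / poly d z))"
        using coord_F z by (simp add: trace_mult_sum_scale)
      also have "\<dots> = poly (\<Sum>k\<le>cdim g. \<alpha> k * a k b) z / poly d z"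
        by (simp add: poly_sum sum_divide_distrib)
      finally show "trace (coord b ** (\<Sum>k\<le>cdim g. poly (\<alpha> k) z \<odot> F k z)) = 0"
        using \<alpha>(2) \<open>b \<in> B\<close> by simp
    qed
  qed
  with \<alpha>(1) show ?thesis by auto
qed

lemma rational_matrix_common_denominator:
  assumes "rational_matrix_no_poles_on D U"
  obtains q R where "\<And>z. z \<in> U \<Longrightarrow> poly q z \<noteq> 0"
    "\<And>z i j. z \<in> U \<Longrightarrow> D z $ i $ j = poly (R i j) z / poly q z"
proof -
  obtain P Q where PQ: "\<And>i j x. D x $ i $ j = poly (P i j) x / poly (Q i j) x"
    "\<And>i j x. x \<in> U \<Longrightarrow> poly (Q i j) x \<noteq> 0"
    using assms unfolding rational_matrix_no_poles_on_def by metis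
  define cofactor where "cofactor i j = (\<Prod>p\<in>UNIV - {(i, j)}. case_prod Q p)" for i j
  define q where "q = (\<Prod>p\<in>UNIV. case_prod Q p)"
  have q: "q = Q i j * cofactor i j" for i j
    unfolding q_def cofactor_def by (simp add: prod.remove[of UNIV "(i, j)"])
  show ?thesis
  proof (rule that[of q "\<lambda>i j. P i j * cofactor i j"])
    show "poly q z \<noteq> 0" if "z \<in> U" for z
      using PQ(2) that by (auto simp: q_def poly_prod)
    show "D z $ i $ j = poly (P i j * cofactor i j) z / poly q z" if "z \<in> U" for z i j
    proof -
      have "poly (cofactor i j) z \<noteq> 0"
        using PQ(2) that by (auto simp: cofactor_def poly_prod)
      then show ?thesis by (simp add: PQ(1) q[of i j])
    qed
  qed
qed

lemma has_field_derivative_poly_div_power: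
  fixes p d :: "complex poly"
  assumes d: "poly d y \<noteq> 0"
  shows "((\<lambda>z. poly p z / poly d z ^ e) has_field_derivative
    poly (pderiv p * d - of_nat e * p * pderiv d) y / poly d y ^ (e + 1)) (at y)"
proof -
  have "((\<lambda>z. poly p z / poly d z ^ e) has_field_derivative
      (poly (pderiv p) y * poly d y ^ e - poly p y * (of_nat e * poly (pderiv d) y * poly d y ^ (e - 1)))
        / (poly d y ^ e * poly d y ^ e)) (at y)"
    using d DERIV_power[OF poly_DERIV[of d y], of e]
    by (intro DERIV_divide poly_DERIV) (auto simp: mult.assoc)
  moreover have "(poly (pderiv p) y * poly d y ^ e - poly p y * (of_nat e * poly (pderiv d) y * poly d y ^ (e - 1)))
        / (poly d y ^ e * poly d y ^ e)
      = poly (pderiv p * d - of_nat e * p * pderiv d) y / poly d y ^ (e + 1)"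
    using d by (cases e) (simp_all add: field_simps power_add)
  ultimately show ?thesis by simp
qed

lemma has_matrix_derivative_rational:
  fixes N :: "'m::finite \<Rightarrow> 'n::finite \<Rightarrow> complex poly"
  assumes "open S" "y \<in> S" "\<And>z. z \<in> S \<Longrightarrow> poly d z \<noteq> 0"
    and "\<And>z i j. z \<in> S \<Longrightarrow> F z $ i $ j = poly (N i j) z / poly d z ^ e"
  shows "has_matrix_derivative F
    (\<chi> i j. poly (pderiv (N i j) * d - of_nat e * N i j * pderiv d) y / poly d y ^ (e + 1)) y"
  using assms has_field_derivative_transform_within_open[OF has_field_derivative_poly_div_power]
  by (simp add: has_matrix_derivative_def)

lemma has_matrix_derivative_mderiv: "has_matrix_derivative F F' y \<Longrightarrow> has_matrix_derivative F (mderiv F y) y"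
  by (simp add: mderiv_eqI)

section \<open>The sequence \<open>D\<^sub>k\<close>\<close>

lemma Dk_rational:
  fixes D \<Psi> :: "complex \<Rightarrow> complex^'n^'n"
  assumes S: "open S" and d: "\<And>z. z \<in> S \<Longrightarrow> poly d z \<noteq> 0"
    and D: "\<And>z i j. z \<in> S \<Longrightarrow> D z $ i $ j = poly (R i j) z / poly d z"
    and Dk_0: "\<And>z i j. z \<in> S \<Longrightarrow> Dk \<Psi> D x2 E2 0 z $ i $ j = poly (N0 i j) z / poly d z ^ 2"
  shows "\<exists>N. \<forall>z\<in>S. \<forall>i j. Dk \<Psi> D x2 E2 k z $ i $ j = poly (N i j) z / poly d z ^ (k + 2)"
proof (induction k)
  case 0
  show ?case using Dk_0 by (intro exI[of _ N0]) (simp add: power2_eq_square)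
next
  case (Suc k)
  then obtain N where N: "\<And>z i j. z \<in> S \<Longrightarrow> Dk \<Psi> D x2 E2 k z $ i $ j = poly (N i j) z / poly d z ^ (k + 2)"
    by blast
  define N' where "N' i j = pderiv (N i j) * d - of_nat (k + 2) * N i j * pderiv d
      + (\<Sum>l\<in>UNIV. N i l * R l j - R i l * N l j)" for i j
  have "Dk \<Psi> D x2 E2 (Suc k) z $ i $ j = poly (N' i j) z / poly d z ^ (Suc k + 2)" if z: "z \<in> S" for z i j
  proof -
    have "mderiv (Dk \<Psi> D x2 E2 k) z $ i $ j
        = poly (pderiv (N i j) * d - of_nat (k + 2) * N i j * pderiv d) z / poly d z ^ (k + 2 + 1)"
      using mderiv_eqI[OF has_matrix_derivative_rational[OF S z d N]] by simp
    moreover have "mbracket (Dk \<Psi> D x2 E2 k z) (D z) $ i $ j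
        = poly (\<Sum>l\<in>UNIV. N i l * R l j - R i l * N l j) z / poly d z ^ (k + 2 + 1)"
    proof -
      have "mbracket (Dk \<Psi> D x2 E2 k z) (D z) $ i $ j
          = (\<Sum>l\<in>UNIV. poly (N i l) z / poly d z ^ (k + 2) * (poly (R l j) z / poly d z)
                     - poly (R i l) z / poly d z * (poly (N l j) z / poly d z ^ (k + 2)))"
        by (simp add: mbracket_def matrix_matrix_mult_def N[OF z] D[OF z] sum_subtractf)
      also have "\<dots> = (\<Sum>l\<in>UNIV. (poly (N i l) z * poly (R l j) z - poly (R i l) z * poly (N l j) z)
          / poly d z ^ (k + 2 + 1))"
        using d[OF z] by (intro sum.cong refl) (simp add: field_simps)
      finally show ?thesis by (simp add: sum_divide_distrib poly_sum)
    qed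
    ultimately show ?thesis by (simp add: N'_def add_divide_distrib)
  qed
  then show ?case by blast
qed

lemma Dk_rational_entries:
  fixes D \<Psi> :: "complex \<Rightarrow> complex^'n^'n"
  assumes "rational_matrix_no_poles_on D U" "open U"
  obtains d N where "\<And>z. z \<in> U - {x2} \<Longrightarrow> poly d z \<noteq> 0"
    "\<And>k z i j. z \<in> U - {x2} \<Longrightarrow> Dk \<Psi> D x2 E2 k z $ i $ j = poly (N k i j) z / poly d z ^ (k + 2)"
proof -
  obtain q R where q: "\<And>z. z \<in> U \<Longrightarrow> poly q z \<noteq> 0"
    and R: "\<And>z i j. z \<in> U \<Longrightarrow> D z $ i $ j = poly (R i j) z / poly q z"
    using rational_matrix_common_denominator[OF assms(1)] by metis
  define d where "d = [:-x2, 1:] * q"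
  have S: "open (U - {x2})" using assms(2) by (simp add: open_delete)
  have d: "poly d z \<noteq> 0" if "z \<in> U - {x2}" for z
    using q that by (simp add: d_def)
  have D: "D z $ i $ j = poly ([:-x2, 1:] * R i j) z / poly d z" if "z \<in> U - {x2}" for z i j
  proof -
    have "poly [:-x2, 1:] z \<noteq> 0" using that by simp
    then show ?thesis
      using R[of z] that by (simp only: d_def poly_mult mult_divide_mult_cancel_left) simp
  qed
  have Dk_0: "Dk \<Psi> D x2 E2 0 z $ i $ j
      = poly (smult (Mconj \<Psi> x2 E2 $ i $ j) (q ^ 2)) z / poly d z ^ 2" if "z \<in> U - {x2}" for z i j
  proof -
    have "poly d z ^ 2 = poly q z ^ 2 * (z - x2) ^ 2"
      by (simp add: d_def power2_eq_square algebra_simps)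
    then show ?thesis
      using q[of z] that by (simp add: mult_divide_mult_cancel_left)
  qed
  have "\<forall>k. \<exists>N. \<forall>z\<in>U - {x2}. \<forall>i j.
      Dk \<Psi> D x2 E2 k z $ i $ j = poly (N i j) z / poly d z ^ (k + 2)"
    using Dk_rational[OF S d D Dk_0] by blast
  then obtain N where "\<forall>k. \<forall>z\<in>U - {x2}. \<forall>i j.
      Dk \<Psi> D x2 E2 k z $ i $ j = poly (N k i j) z / poly d z ^ (k + 2)"
    by metis
  with d that show ?thesis by blast
qed

lemma Dk_mem_lie_algebra:
  fixes g :: "(complex^'n^'n) set"
  assumes g: "csubspace g" "\<And>A B. A \<in> g \<Longrightarrow> B \<in> g \<Longrightarrow> mbracket A B \<in> g"
    and S: "open S" and D: "\<And>z. z \<in> S \<Longrightarrow> D z \<in> g" and M: "Mconj \<Psi> x2 E2 \<in> g"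
    and der: "\<And>k z. z \<in> S \<Longrightarrow> has_matrix_derivative (Dk \<Psi> D x2 E2 k) (mderiv (Dk \<Psi> D x2 E2 k) z) z"
    and z: "z \<in> S"
  shows "Dk \<Psi> D x2 E2 k z \<in> g"
  using z
proof (induction k arbitrary: z)
  case 0
  then show ?case using csubspace_scale[OF g(1) M] by simp
next
  case (Suc k)
  have "mderiv (Dk \<Psi> D x2 E2 k) z \<in> g"
    using Suc by (intro has_matrix_derivative_in_csubspace[OF g(1) S _ _ der]) auto
  moreover have "mbracket (Dk \<Psi> D x2 E2 k z) (D z) \<in> g"
    using Suc D by (intro g(2)) auto
  ultimately show ?case by (simp add: csubspace_add[OF g(1)])
qed

lemma deriv_iterate_W2:
  assumes Psi: "fundamental_solution \<Psi> D G U" and G: "G \<subseteq> {A. invertible A}" and U: "open U"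
    and der: "\<And>k z. z \<in> U - {x2} \<Longrightarrow>
      has_matrix_derivative (Dk \<Psi> D x2 E2 k) (mderiv (Dk \<Psi> D x2 E2 k) z) z"
    and z: "z \<in> U - {x2}"
  shows "(deriv ^^ k) (\<lambda>y. W2 \<Psi> y E1 x2 E2) z = trace (Mconj \<Psi> z E1 ** Dk \<Psi> D x2 E2 k z)"
  using z
proof (induction k arbitrary: z)
  case 0
  then show ?case by (simp add: W2_def cmat_scale_mult_right trace_cmat_scale)
next
  case (Suc k)
  let ?M = "\<lambda>x. Mconj \<Psi> x E1" and ?F = "Dk \<Psi> D x2 E2 k"
  have S: "open (U - {x2})" using U by (simp add: open_delete)
  have "((\<lambda>x. trace (?M x ** ?F x)) has_field_derivative
      trace (mbracket (D z) (?M z) ** ?F z + ?M z ** mderiv ?F z)) (at z)"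
    using Suc.prems
    by (intro has_matrix_derivative_trace has_matrix_derivative_mult
        has_matrix_derivative_Mconj[OF Psi G U] der) auto
  also have "trace (mbracket (D z) (?M z) ** ?F z + ?M z ** mderiv ?F z)
      = trace (?M z ** Dk \<Psi> D x2 E2 (Suc k) z)"
    by (simp add: trace_add trace_mbracket_mult matrix_add_ldistrib)
  finally have "((deriv ^^ k) (\<lambda>y. W2 \<Psi> y E1 x2 E2) has_field_derivative
      trace (?M z ** Dk \<Psi> D x2 E2 (Suc k) z)) (at z)"
    by (rule has_field_derivative_transform_within_open[OF _ S Suc.prems]) (simp add: Suc.IH)
  then show ?case by (simp add: DERIV_imp_deriv)
qed

theorem mainTheorem2:
  fixes G g :: "(complex^'n^'n) set"
    and D \<Psi> :: "complex \<Rightarrow> complex^'n^'n"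
    and U :: "complex set"
    and x2 :: complex and E1 E2 :: "complex^'n^'n"
  assumes G: "complex_reductive_lie_group G g"
    and Dg: "\<forall>x\<in>U. D x \<in> g"
    and Drat: "rational_matrix_no_poles_on D U"
    and U: "open U" "connected U" "simply_connected U"
    and Psi: "fundamental_solution \<Psi> D G U"
    and x2: "x2 \<in> U" and E2: "E2 \<in> g" and E1: "E1 \<in> g"
  shows "\<exists>\<alpha> :: nat \<Rightarrow> complex poly.
           (\<exists>k\<le>cdim g. \<alpha> k \<noteq> 0) \<and>
           (\<forall>x1\<in>U - {x2}. (\<Sum>k\<le>cdim g. poly (\<alpha> k) x1 \<odot> Dk \<Psi> D x2 E2 k x1) = 0) \<and>
           (\<forall>x1\<in>U - {x2}. (\<Sum>k\<le>cdim g. poly (\<alpha> k) x1 *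
               (deriv ^^ k) (\<lambda>y. W2 \<Psi> y E1 x2 E2) x1) = 0)"
proof -
  let ?S = "U - {x2}" and ?m = "cdim g"
  have lie: "complex_linear_lie_group G g" "csubspace g"
    "\<And>A B. A \<in> g \<Longrightarrow> B \<in> g \<Longrightarrow> mbracket A B \<in> g"
    using G by (auto simp: complex_reductive_lie_group_def reductive_lie_algebra_def)
  have G_inv: "G \<subseteq> {A. invertible A}"
    using lie(1) by (simp add: complex_linear_lie_group_def)
  obtain d N where d: "\<And>z. z \<in> ?S \<Longrightarrow> poly d z \<noteq> 0"
    and N: "\<And>k z i j. z \<in> ?S \<Longrightarrow> Dk \<Psi> D x2 E2 k z $ i $ j = poly (N k i j) z / poly d z ^ (k + 2)"
    using Dk_rational_entries[OF Drat U(1)] by metis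
  have S: "open ?S" using U(1) by (simp add: open_delete)
  have Dk_der: "has_matrix_derivative (Dk \<Psi> D x2 E2 k) (mderiv (Dk \<Psi> D x2 E2 k) z) z" if "z \<in> ?S" for k z
    by (rule has_matrix_derivative_mderiv[OF has_matrix_derivative_rational[OF S that d N]])
  have "Mconj \<Psi> x2 E2 \<in> g"
    using conj_mem_lie_algebra[OF lie(1)] Psi x2 E2 by (simp add: Mconj_def fundamental_solution_def)
  then have Dk_g: "Dk \<Psi> D x2 E2 k z \<in> g" if "z \<in> ?S" for k z
    using Dk_mem_lie_algebra[OF lie(2,3) S _ _ Dk_der that] Dg by auto
  have common_denominator:
    "Dk \<Psi> D x2 E2 k z $ i $ j = poly (N k i j * d ^ (?m - k)) z / poly (d ^ (?m + 2)) z"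
    if "k \<le> ?m" "z \<in> ?S" for k z i j
    by (simp only: N[OF that(2)] poly_div_power_common_denominator[OF that(1) d[OF that(2)]])
  have "\<exists>\<alpha>. (\<exists>k\<le>?m. \<alpha> k \<noteq> 0) \<and> (\<forall>z\<in>?S. (\<Sum>k\<le>?m. poly (\<alpha> k) z \<odot> Dk \<Psi> D x2 E2 k z) = 0)"
    by (rule polynomial_relation_in_csubspace[OF lie(2) _ common_denominator]) (rule Dk_g)
  then obtain \<alpha> where \<alpha>: "\<exists>k\<le>?m. \<alpha> k \<noteq> 0"
    and rel: "\<forall>z\<in>?S. (\<Sum>k\<le>?m. poly (\<alpha> k) z \<odot> Dk \<Psi> D x2 E2 k z) = 0"
    by blast
  have "(\<Sum>k\<le>?m. poly (\<alpha> k) z * (deriv ^^ k) (\<lambda>y. W2 \<Psi> y E1 x2 E2) z) = 0" if "z \<in> ?S" for z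
  proof -
    have "(\<Sum>k\<le>?m. poly (\<alpha> k) z * (deriv ^^ k) (\<lambda>y. W2 \<Psi> y E1 x2 E2) z)
        = trace (Mconj \<Psi> z E1 ** (\<Sum>k\<le>?m. poly (\<alpha> k) z \<odot> Dk \<Psi> D x2 E2 k z))"
      using deriv_iterate_W2[OF Psi G_inv U(1) Dk_der that] by (simp add: trace_mult_sum_scale)
    then show ?thesis using rel that by (simp add: trace_def)
  qed
  with \<alpha> rel show ?thesis by (intro exI[of _ \<alpha>] conjI) auto
qed

end
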